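(* In the setting of the context it holds $$E\mathcal L_G(\upsilon^*_G)-E\mathcal L_G(\upsilon^* )\le\tfrac12\|\mathcal G\upsilon^*\|^2\le\frac{C_{G|\Gamma}+1}2\,\|Gf^*\|^2 .$$
   Context: $\mathcal X^d,\mathcal Y^d$ are finite-dimensional Euclidean spaces, $\Upsilon^d=\mathcal X^d\times\mathcal Y^d$ with points $\upsilon=(f,g)$, $A:\mathcal X^d\to\mathcal Y^d$ is a smooth, possibly nonlinear operator, $\sigma>0$ and $\lambda=\sigma^{-2}$. One observes a random $Y\in\mathcal Y^d$ with $EY=g^*:=A(f^* )$. $G^2$ on $\mathcal X^d$ and $\Gamma^2$ on $\mathcal Y^d$ are symmetric positive prior precision operators; the prior means are $f_0=0$, $g_0=0$ (reduction by reparametrization made in the paper). Set $$\mathcal L_G(\upsilon)=-\tfrac1{2\sigma^2}\|Y-g\|^2-\tfrac\lambda2\|g-A(f)\|^2-\tfrac12\|Gf\|^2-\tfrac12\|\Gamma g\|^2 ,$$ so that, up to an omitted additive constant, $E\mathcal L_G(\upsilon)=-\frac1{2\sigma^2}\|g^*-g\|^2-\frac\lambda2\|g-A(f)\|^2-\frac12\|Gf\|^2-\frac12\|\Gamma g\|^2$. $\Upsilon^\circ\subseteq\Upsilon^d$ is an open convex set, containing $\upsilon^*:=(f^*,g^* )$, on which $E\mathcal L_G$ is concave, and $\upsilon^*_G=\arg\max_{\Upsilon^\circ}E\mathcal L_G$. Notation: $\mathcal G^2=\mathrm{block}\{G^2,\Gamma^2\}$ (block-diagonal), so $\|\mathcal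 G\upsilon\|^2=\|Gf\|^2+\|\Gamma g\|^2$. Standing condition ($G|\Gamma$): $g_0=A(f_0)$ and $C_{G|\Gamma}$ is a constant with $\|\Gamma\{A(f^* )-g_0\}\|^2\le C_{G|\Gamma}\|G(f^*-f_0)\|^2$ (here $f_0=0$, $g_0=0$) and $\mathrm{tr}(\sigma^2\Gamma^2+I)^{-1}\le C_{G|\Gamma}\mathrm{tr}\{F_G^{-1}F\}$, where $F_G$, $F$ are the $ff$-blocks at $\upsilon_G^*$ of the negative Hessians of $E\mathcal L_G$ and of $E\mathcal L_G$ without the two penalty terms. *)

theory Defs
  imports "HOL-Probability.Probability"
begin

text \<open>Smoothness means \<open>C\<^sup>\<infinity>\<close> on the whole space: all iterated directional derivatives exist
  and are continuous.\<close>

primrec Ck :: "nat \<Rightarrow> ('a::real_normed_vector \<Rightarrow> 'b::real_normed_vector) \<Rightarrow> bool" where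
  "Ck 0 f \<longleftrightarrow> continuous_on UNIV f"
| "Ck (Suc k) f \<longleftrightarrow> f differentiable_on UNIV \<and>
     (\<forall>v. Ck k (\<lambda>x. frechet_derivative f (at x) v))"

definition smooth :: "('a::real_normed_vector \<Rightarrow> 'b::real_normed_vector) \<Rightarrow> bool" where
  "smooth f \<longleftrightarrow> (\<forall>k. Ck k f)"

definition sym_pos_op :: "('a::real_inner \<Rightarrow> 'a) \<Rightarrow> bool" where
  "sym_pos_op T \<longleftrightarrow> linear T \<and> (\<forall>u v. T u \<bullet> v = u \<bullet> T v) \<and> (\<forall>u. 0 \<le> T u \<bullet> u)"

definition op_trace :: "('a::euclidean_space \<Rightarrow> 'a) \<Rightarrow> real" where
  "op_trace T = (\<Sum>b\<in>Basis. T b \<bullet> b)"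

text \<open>For a twice differentiable \<open>h\<close>, \<open>hessian h x\<close> is the self-adjoint linear operator
  representing the second derivative of \<open>h\<close> at \<open>x\<close>.\<close>

definition gradient :: "('a::real_inner \<Rightarrow> real) \<Rightarrow> 'a \<Rightarrow> 'a" where
  "gradient h x = (THE D. GDERIV h x :> D)"

definition hessian :: "('a::real_inner \<Rightarrow> real) \<Rightarrow> 'a \<Rightarrow> 'a \<Rightarrow> 'a" where
  "hessian h x = frechet_derivative (gradient h) (at x)"

text \<open>The \<open>ff\<close>-block (restriction to, and projection on, the first component) of the negative
  Hessian.\<close>

definition neg_hessian_ff ::
  "('a::real_inner \<times> 'b::real_inner \<Rightarrow> real) \<Rightarrow> 'a \<times> 'b \<Rightarrow> 'a \<Rightarrow> 'a" where
  "neg_hessian_ff h \<upsilon> u = - fst (hessian h \<upsilon> (u, 0))"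

definition lam :: "real \<Rightarrow> real" where
  "lam \<sigma> = 1 / \<sigma>\<^sup>2"

text \<open>The log-likelihood without the penalty terms, and with them.  The arguments \<open>G\<close> and \<open>\<Gamma>\<close>
  are the symmetric positive square roots of the prior precision operators; the prior means are
  zero.\<close>

definition loglik ::
  "real \<Rightarrow> ('a::euclidean_space \<Rightarrow> 'b::euclidean_space) \<Rightarrow> 'b \<Rightarrow> 'a \<times> 'b \<Rightarrow> real" where
  "loglik \<sigma> A y \<upsilon> = (case \<upsilon> of (f, g) \<Rightarrow>
     - (1 / (2 * \<sigma>\<^sup>2)) * (norm (y - g))\<^sup>2 - lam \<sigma> / 2 * (norm (g - A f))\<^sup>2)"

definition loglik_pen ::
  "real \<Rightarrow> ('a::euclidean_space \<Rightarrow> 'b::euclidean_space) \<Rightarrow> ('a \<Rightarrow> 'a) \<Rightarrow> ('b \<Rightarrow> 'b) \<Rightarrow>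
   'b \<Rightarrow> 'a \<times> 'b \<Rightarrow> real" where
  "loglik_pen \<sigma> A G \<Gamma> y \<upsilon> =
     loglik \<sigma> A y \<upsilon> - (norm (G (fst \<upsilon>)))\<^sup>2 / 2 - (norm (\<Gamma> (snd \<upsilon>)))\<^sup>2 / 2"

definition exp_loglik ::
  "'w measure \<Rightarrow> ('w \<Rightarrow> 'b) \<Rightarrow> real \<Rightarrow> ('a::euclidean_space \<Rightarrow> 'b::euclidean_space) \<Rightarrow>
   'a \<times> 'b \<Rightarrow> real" where
  "exp_loglik M Y \<sigma> A \<upsilon> = (\<integral>w. loglik \<sigma> A (Y w) \<upsilon> \<partial>M)"

definition exp_loglik_pen ::
  "'w measure \<Rightarrow> ('w \<Rightarrow> 'b) \<Rightarrow> real \<Rightarrow> ('a::euclidean_space \<Rightarrow> 'b::euclidean_space) \<Rightarrow>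
   ('a \<Rightarrow> 'a) \<Rightarrow> ('b \<Rightarrow> 'b) \<Rightarrow> 'a \<times> 'b \<Rightarrow> real" where
  "exp_loglik_pen M Y \<sigma> A G \<Gamma> \<upsilon> = (\<integral>w. loglik_pen \<sigma> A G \<Gamma> (Y w) \<upsilon> \<partial>M)"

text \<open>The expected log-likelihood is the usual noiseless expression up to the additive constant
  \<open>- E \<parallel>Y - E Y\<parallel>\<^sup>2 / (2 \<sigma>\<^sup>2)\<close>.\<close>

lemma exp_loglik_pen_eq:
  fixes Y :: "'w \<Rightarrow> 'b::euclidean_space" and A :: "'a::euclidean_space \<Rightarrow> 'b"
  assumes M: "prob_space M"
    and Y: "integrable M Y" and Y2: "integrable M (\<lambda>w. (norm (Y w))\<^sup>2)"
    and m: "integral\<^sup>L M Y = m"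
  shows "exp_loglik_pen M Y \<sigma> A G \<Gamma> (f, g) =
    - (1 / (2 * \<sigma>\<^sup>2)) * (norm (m - g))\<^sup>2 - lam \<sigma> / 2 * (norm (g - A f))\<^sup>2
    - (norm (G f))\<^sup>2 / 2 - (norm (\<Gamma> g))\<^sup>2 / 2
    - (1 / (2 * \<sigma>\<^sup>2)) * (\<integral>w. (norm (Y w - m))\<^sup>2 \<partial>M)"
proof -
  interpret prob_space M by (fact M)
  have ex: "(norm (y - c))\<^sup>2 = (norm y)\<^sup>2 - 2 * (y \<bullet> c) + (norm c)\<^sup>2" for y c :: 'b
    by (simp add: power2_norm_eq_inner inner_diff inner_commute algebra_simps)
  have int: "integrable M (\<lambda>w. (norm (Y w - c))\<^sup>2)" for c
    unfolding ex using Y Y2 by auto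
  have E: "(\<integral>w. (norm (Y w - c))\<^sup>2 \<partial>M) = (\<integral>w. (norm (Y w))\<^sup>2 \<partial>M) - 2 * (m \<bullet> c) + (norm c)\<^sup>2" for c
    unfolding ex using Y Y2 by (simp add: m prob_space)
  have "(\<integral>w. (norm (Y w - g))\<^sup>2 \<partial>M) = (\<integral>w. (norm (Y w - m))\<^sup>2 \<partial>M) + (norm (m - g))\<^sup>2"
    unfolding E by (simp add: power2_norm_eq_inner inner_diff inner_commute algebra_simps)
  then have E': "- (1 / (2 * \<sigma>\<^sup>2)) * (\<integral>w. (norm (Y w - g))\<^sup>2 \<partial>M) =
      - (1 / (2 * \<sigma>\<^sup>2)) * (norm (m - g))\<^sup>2 - (1 / (2 * \<sigma>\<^sup>2)) * (\<integral>w. (norm (Y w - m))\<^sup>2 \<partial>M)"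
    by (simp add: distrib_left)
  have "exp_loglik_pen M Y \<sigma> A G \<Gamma> (f, g) =
      - (1 / (2 * \<sigma>\<^sup>2)) * (\<integral>w. (norm (Y w - g))\<^sup>2 \<partial>M) - lam \<sigma> / 2 * (norm (g - A f))\<^sup>2
      - (norm (G f))\<^sup>2 / 2 - (norm (\<Gamma> g))\<^sup>2 / 2"
    unfolding exp_loglik_pen_def loglik_pen_def loglik_def prod.case fst_conv snd_conv
    using int[of g] by (simp add: prob_space)
  with E' show ?thesis by linarith
qed

text \<open>Condition \<open>(G|\<Gamma>)\<close> with constant \<open>C\<close>, for arbitrary prior means \<open>f0\<close>, \<open>g0\<close>.
  The operators \<open>F_G\<close> and \<open>F\<close> are the \<open>ff\<close>-blocks at the penalized maximizer;
  \<open>inv F_G\<close> is the inverse operator provided \<open>F_G\<close> is nonsingular.\<close>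

definition cond_G_Gamma ::
  "real \<Rightarrow> real \<Rightarrow> ('a::euclidean_space \<Rightarrow> 'b::euclidean_space) \<Rightarrow> ('a \<Rightarrow> 'a) \<Rightarrow> ('b \<Rightarrow> 'b) \<Rightarrow>
   'a \<Rightarrow> 'b \<Rightarrow> 'a \<Rightarrow> ('a \<Rightarrow> 'a) \<Rightarrow> ('a \<Rightarrow> 'a) \<Rightarrow> bool" where
  "cond_G_Gamma C \<sigma> A G \<Gamma> f0 g0 fstar F_G F \<longleftrightarrow>
     g0 = A f0 \<and>
     (norm (\<Gamma> (A fstar - g0)))\<^sup>2 \<le> C * (norm (G (fstar - f0)))\<^sup>2 \<and>
     op_trace (inv (\<lambda>v. \<sigma>\<^sup>2 *\<^sub>R \<Gamma> (\<Gamma> v) + v)) \<le> C * op_trace (inv F_G \<circ> F)"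

abbreviation block :: "('a \<Rightarrow> 'a) \<Rightarrow> ('b \<Rightarrow> 'b) \<Rightarrow> 'a \<times> 'b \<Rightarrow> 'a \<times> 'b" where
  "block \<equiv> map_prod"

end

theory Submission
  imports Defs
begin

text \<open>
  Up to the additive constant \<open>- E \<parallel>Y - E Y\<parallel>\<^sup>2 / (2 \<sigma>\<^sup>2)\<close>, the expected penalized log-likelihood
  is minus a nonnegative combination of four squares: two for the fit and two for the penalty.  The true point
  \<open>(f\<^sup>*, A f\<^sup>*)\<close> fits perfectly, so there only the penalty \<open>\<parallel>block G \<Gamma> \<upsilon>\<^sup>*\<parallel>\<^sup>2 / 2\<close> is lost against
  the constant, while no other point can exceed the constant.  Hence the gain from moving to any
  point, the penalized maximizer in particular, is at most that penalty
  (\<open>exp_loglik_pen_gain_le\<close>).  The second inequality splits the penalty over the two components and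
  absorbs \<open>\<parallel>\<Gamma> (A f\<^sup>*)\<parallel>\<^sup>2\<close> into \<open>C \<parallel>G f\<^sup>*\<parallel>\<^sup>2\<close>, which is the first bound in \<open>(G|\<Gamma>)\<close> for zero prior means.
\<close>

lemma norm_block_squared:
  "(norm (block G \<Gamma> (f, g)))\<^sup>2 = (norm (G f))\<^sup>2 + (norm (\<Gamma> g))\<^sup>2"
  by (simp add: norm_Pair)

text \<open>
  The bias bound holds for an arbitrary competitor \<open>\<upsilon>\<close>: the variance constant cancels in the
  difference, the fit terms vanish at \<open>(f\<^sup>*, A f\<^sup>*)\<close>, and every term at \<open>\<upsilon>\<close> is nonpositive.
\<close>

lemma exp_loglik_pen_gain_le:
  fixes Y :: "'w \<Rightarrow> 'b::euclidean_space" and A :: "'a::euclidean_space \<Rightarrow> 'b"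
  assumes "prob_space M"
    and "integrable M Y" and "integrable M (\<lambda>w. (norm (Y w))\<^sup>2)"
    and "integral\<^sup>L M Y = A fstar"
  shows "exp_loglik_pen M Y \<sigma> A G \<Gamma> \<upsilon> - exp_loglik_pen M Y \<sigma> A G \<Gamma> (fstar, A fstar)
    \<le> 1 / 2 * (norm (block G \<Gamma> (fstar, A fstar)))\<^sup>2"
proof -
  define K where "K = 1 / (2 * \<sigma>\<^sup>2) * (\<integral>w. (norm (Y w - A fstar))\<^sup>2 \<partial>M)"
  define misfit where "misfit f g =
    1 / (2 * \<sigma>\<^sup>2) * (norm (A fstar - g))\<^sup>2 + lam \<sigma> / 2 * (norm (g - A f))\<^sup>2" for f g
  have eq: "exp_loglik_pen M Y \<sigma> A G \<Gamma> (f, g)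
      = - misfit f g - (norm (block G \<Gamma> (f, g)))\<^sup>2 / 2 - K" for f g
    unfolding exp_loglik_pen_eq[OF assms] norm_block_squared misfit_def K_def
    by (simp add: add_divide_distrib)
  obtain f g where \<upsilon>: "\<upsilon> = (f, g)"
    by (cases \<upsilon>)
  have "0 \<le> misfit f g" and "misfit fstar (A fstar) = 0" and "0 \<le> (norm (block G \<Gamma> (f, g)))\<^sup>2"
    by (simp_all add: misfit_def lam_def)
  then show ?thesis
    unfolding \<upsilon> eq by linarith
qed

theorem theorem4p8:
  fixes M :: "'w measure"
    and Y :: "'w \<Rightarrow> 'b::euclidean_space"
    and A :: "'a::euclidean_space \<Rightarrow> 'b"
    and G :: "'a \<Rightarrow> 'a" and \<Gamma> :: "'b \<Rightarrow> 'b"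
    and \<sigma> C :: real
    and fstar :: 'a and gstar :: 'b
    and \<Upsilon> :: "('a \<times> 'b) set"
    and \<upsilon>star \<upsilon>G :: "'a \<times> 'b"
  assumes "prob_space M"
    and "\<sigma> > 0"
    and "smooth A"
    and "sym_pos_op G" and "sym_pos_op \<Gamma>"
    and "integrable M Y" and "integrable M (\<lambda>w. (norm (Y w))\<^sup>2)"
    and "gstar = A fstar" and "integral\<^sup>L M Y = gstar"
    and "\<upsilon>star = (fstar, gstar)"
    and "open \<Upsilon>" and "convex \<Upsilon>" and "\<upsilon>star \<in> \<Upsilon>"
    and "concave_on \<Upsilon> (exp_loglik_pen M Y \<sigma> A G \<Gamma>)"
    and "is_arg_max (exp_loglik_pen M Y \<sigma> A G \<Gamma>) (\<lambda>\<upsilon>. \<upsilon> \<in> \<Upsilon>) \<upsilon>G"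
    and "cond_G_Gamma C \<sigma> A G \<Gamma> 0 0 fstar
           (neg_hessian_ff (exp_loglik_pen M Y \<sigma> A G \<Gamma>) \<upsilon>G)
           (neg_hessian_ff (exp_loglik M Y \<sigma> A) \<upsilon>G)"
  shows "exp_loglik_pen M Y \<sigma> A G \<Gamma> \<upsilon>G - exp_loglik_pen M Y \<sigma> A G \<Gamma> \<upsilon>star
           \<le> 1 / 2 * (norm (block G \<Gamma> \<upsilon>star))\<^sup>2
       \<and> 1 / 2 * (norm (block G \<Gamma> \<upsilon>star))\<^sup>2 \<le> (C + 1) / 2 * (norm (G fstar))\<^sup>2"
proof
  note \<upsilon>star = \<open>\<upsilon>star = (fstar, gstar)\<close> \<open>gstar = A fstar\<close>
  have mean: "integral\<^sup>L M Y = A fstar"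
    using \<open>integral\<^sup>L M Y = gstar\<close> \<open>gstar = A fstar\<close> by simp
  show "exp_loglik_pen M Y \<sigma> A G \<Gamma> \<upsilon>G - exp_loglik_pen M Y \<sigma> A G \<Gamma> \<upsilon>star
      \<le> 1 / 2 * (norm (block G \<Gamma> \<upsilon>star))\<^sup>2"
    unfolding \<upsilon>star
    by (rule exp_loglik_pen_gain_le) (fact assms mean)+
  have "(norm (\<Gamma> (A fstar)))\<^sup>2 \<le> C * (norm (G fstar))\<^sup>2"
    using assms(16) by (simp add: cond_G_Gamma_def)
  then show "1 / 2 * (norm (block G \<Gamma> \<upsilon>star))\<^sup>2 \<le> (C + 1) / 2 * (norm (G fstar))\<^sup>2"
    unfolding \<upsilon>star norm_block_squared by (simp add: algebra_simps)
qed

end
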